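(* Let $n\ge 3$, let $G_n$ be the straight linear 2-tree on $n$ vertices and $m=n-2$. Then the resistance distance between vertices $1$ and $n$ is \[ r(1,n)=\frac{2F_{m+1}^2}{L_{m+1}L_m}+\sum_{i=1}^{m-1}\frac{F_iF_{i+1}}{L_iL_{i+1}}=\frac{m+1}{5}+\frac{4F_{m+1}}{5L_{m+1}}. \]
   Context: The straight linear 2-tree $G_n$ is the graph with vertex set $\{1,\dots,n\}$ in which $\{i,j\}$ is an edge if and only if $0<|i-j|\le 2$. Every edge is a unit resistor; resistance distance is $r(i,j)=(\mathbf e_i-\mathbf e_j)^TL^{\dagger}(\mathbf e_i-\mathbf e_j)$ with $L^\dagger$ the Moore–Penrose inverse of the Laplacian of $G_n$. $F_p$ are the Fibonacci numbers ($F_0=0,F_1=1,F_{p+1}=F_p+F_{p-1}$) and $L_p=F_{p-1}+F_{p+1}$ are the Lucas numbers. *)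

theory Defs
  imports Complex_Main "HOL-Number_Theory.Fib" "Jordan_Normal_Form.Matrix"
begin

text \<open>
  Simple graphs on the vertex set \<open>{1..n}\<close> are given by \<open>n\<close> and a set of two-element edges.
  Matrices and vectors are indexed from \<open>0\<close>, so row or column \<open>k\<close> belongs to vertex \<open>k + 1\<close>.
\<close>

definition straight_linear_2tree :: "nat \<Rightarrow> nat set set" where
  "straight_linear_2tree n =
     {{i, j} | i j. i \<in> {1..n} \<and> j \<in> {1..n} \<and>
        0 < \<bar>int i - int j\<bar> \<and> \<bar>int i - int j\<bar> \<le> 2}"

definition degree_of :: "nat set set \<Rightarrow> nat \<Rightarrow> nat" where
  "degree_of E v = card {e \<in> E. v \<in> e}"

definition laplacian :: "nat \<Rightarrow> nat set set \<Rightarrow> real mat" where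
  "laplacian n E = mat n n (\<lambda>(k, l).
     if k = l then real (degree_of E (k + 1))
     else if {k + 1, l + 1} \<in> E then - 1 else 0)"

text \<open>The four Penrose conditions over the reals, and the inverse they determine.\<close>

definition is_mp_inverse :: "real mat \<Rightarrow> real mat \<Rightarrow> bool" where
  "is_mp_inverse A X \<longleftrightarrow>
     X \<in> carrier_mat (dim_col A) (dim_row A) \<and>
     A * X * A = A \<and> X * A * X = X \<and>
     transpose_mat (A * X) = A * X \<and> transpose_mat (X * A) = X * A"

definition mp_inverse :: "real mat \<Rightarrow> real mat" where
  "mp_inverse A = (THE X. is_mp_inverse A X)"

lemma is_mp_inverse_unique:
  assumes "is_mp_inverse A X" and "is_mp_inverse A Y"
  shows "X = Y"
proof -
  define r where "r = dim_row A"
  define c where "c = dim_col A"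
  have A: "A \<in> carrier_mat r c" by (simp add: r_def c_def)
  have X: "X \<in> carrier_mat c r" and Y: "Y \<in> carrier_mat c r"
    using assms by (simp_all add: is_mp_inverse_def r_def c_def)
  note x = assms(1)[unfolded is_mp_inverse_def]
  note y = assms(2)[unfolded is_mp_inverse_def]
  have AX: "A * X \<in> carrier_mat r r" and AY: "A * Y \<in> carrier_mat r r"
    and XA: "X * A \<in> carrier_mat c c" and YA: "Y * A \<in> carrier_mat c c"
    using A X Y by auto
  have "A * X = (A * Y * A) * X" using y by simp
  also have "\<dots> = (A * Y) * (A * X)" by (rule assoc_mult_mat[OF AY A X])
  also have "\<dots> = transpose_mat ((A * X) * (A * Y))"
    using x y by (simp add: transpose_mult[OF AX AY])
  also have "(A * X) * (A * Y) = A * X * A * Y"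
    by (rule assoc_mult_mat[OF AX A Y, symmetric])
  finally have l: "A * X = A * Y" using x y by simp
  have "X * A = X * (A * Y * A)" using y by simp
  also have "\<dots> = X * (A * (Y * A))" by (simp add: assoc_mult_mat[OF A Y A])
  also have "\<dots> = (X * A) * (Y * A)" by (rule assoc_mult_mat[OF X A YA, symmetric])
  also have "\<dots> = transpose_mat ((Y * A) * (X * A))"
    using x y by (simp add: transpose_mult[OF YA XA])
  also have "(Y * A) * (X * A) = Y * (A * (X * A))"
    by (rule assoc_mult_mat[OF Y A XA])
  also have "A * (X * A) = A * X * A" by (rule assoc_mult_mat[OF A X A, symmetric])
  finally have q: "X * A = Y * A" using x y by simp
  have "X = X * A * X" using x by simp
  also have "\<dots> = Y * (A * X)" by (simp add: q assoc_mult_mat[OF Y A X])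
  also have "\<dots> = Y * A * Y" by (simp add: l assoc_mult_mat[OF Y A Y])
  finally show ?thesis using y by simp
qed

lemma mp_inverse_eqI: "is_mp_inverse A X \<Longrightarrow> mp_inverse A = X"
  unfolding mp_inverse_def by (blast intro: the_equality is_mp_inverse_unique)

definition resistance :: "nat \<Rightarrow> nat set set \<Rightarrow> nat \<Rightarrow> nat \<Rightarrow> real" where
  "resistance n E i j =
     (let d = unit_vec n (i - 1) - unit_vec n (j - 1)
      in d \<bullet> (mp_inverse (laplacian n E) *\<^sub>v d))"

text \<open>
  \<open>L\<^sub>p = F\<^sub>p\<^sub>-\<^sub>1 + F\<^sub>p\<^sub>+\<^sub>1\<close>; the case \<open>p = 0\<close> is separate because \<open>F\<^sub>-\<^sub>1 = 1\<close> is not available on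
  \<^typ>\<open>nat\<close>.
\<close>

fun lucas :: "nat \<Rightarrow> nat" where
  "lucas 0 = 2"
| "lucas (Suc p) = fib p + fib (p + 2)"

end

theory Submission
  imports Defs "Jordan_Normal_Form.Determinant"
begin

text \<open>
  If \<open>L v = e\<^sub>1 - e\<^sub>n\<close>, then \<open>L L\<^sup>\<dagger> L = L\<close> and symmetry give \<open>r(1,n) = v\<^sub>1 - v\<^sub>n\<close>, so it suffices to
  exhibit a potential \<open>v\<close>: a linear term plus alternating multiples of Fibonacci numbers.  The
  Moore--Penrose inverse is \<open>(L + P)\<^sup>-\<^sup>1 - P\<close> with \<open>P\<close> the projection onto constants; \<open>L + P\<close> is
  invertible because the maximum principle forces \<open>ker L\<close> to consist of constants.  The sum
  formula follows by induction on \<open>m\<close>, each step being a rational identity in \<open>F\<^sub>m\<close> and \<open>F\<^sub>m\<^sub>+\<^sub>1\<close>.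
\<close>

section \<open>Moore--Penrose inverses\<close>

text \<open>The hypotheses make \<open>P\<close> the orthogonal projection onto the kernel of
  \<open>A\<close>. Both \<open>A * X\<close> and \<open>X * A\<close> come out as
  \<open>1 - P\<close>, which settles all four Penrose conditions.\<close>

lemma is_mp_inverse_exists:
  fixes A P :: "real mat"
  assumes A: "A \<in> carrier_mat n n" and P: "P \<in> carrier_mat n n"
    and PT: "transpose_mat P = P" and PP: "P * P = P"
    and AP: "A * P = 0\<^sub>m n n" and PA: "P * A = 0\<^sub>m n n"
    and ker: "\<And>v. v \<in> carrier_vec n \<Longrightarrow> A *\<^sub>v v = 0\<^sub>v n \<Longrightarrow> P *\<^sub>v v = 0\<^sub>v n \<Longrightarrow> v = 0\<^sub>v n"
  shows "\<exists>X. is_mp_inverse A X"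
proof -
  define B where "B = A + P"
  have B: "B \<in> carrier_mat n n" using A P by (simp add: B_def)
  have BP: "B * P = P" using A P by (simp add: B_def add_mult_distrib_mat[OF A P P] AP PP)
  have PB: "P * B = P" using A P by (simp add: B_def mult_add_distrib_mat[OF P A P] PA PP)
  have "det B \<noteq> 0"
  proof
    assume "det B = 0"
    then obtain v where v: "v \<in> carrier_vec n" "v \<noteq> 0\<^sub>v n" "B *\<^sub>v v = 0\<^sub>v n"
      using det_0_iff_vec_prod_zero[OF B] by blast
    have "P *\<^sub>v v = P *\<^sub>v (B *\<^sub>v v)"
      using assoc_mult_mat_vec[OF P B v(1)] PB by simp
    also have "\<dots> = 0\<^sub>v n" using P by (intro eq_vecI) (auto simp: v(3))
    finally have Pv: "P *\<^sub>v v = 0\<^sub>v n" .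
    have "A *\<^sub>v v = B *\<^sub>v v"
      using A P v(1) Pv by (simp add: B_def add_mult_distrib_mat_vec[OF A P v(1)])
    then show False using ker[OF v(1) _ Pv] v by simp
  qed
  then obtain Y where Y: "Y \<in> carrier_mat n n" and BY: "B * Y = 1\<^sub>m n" and YB: "Y * B = 1\<^sub>m n"
    using det_non_zero_imp_unit[OF B] unfolding Units_def ring_mat_def by auto
  have PY: "P * Y = P"
    using assoc_mult_mat[OF P B Y] P by (simp add: PB BY)
  have YP: "Y * P = P"
    using assoc_mult_mat[OF Y B P] P by (simp add: BP YB)
  \<comment> \<open>On the range of \<open>P\<close>, which is the kernel of \<open>A\<close>,
    \<open>Y\<close> acts as the identity while the pseudoinverse must vanish; subtracting
    \<open>P\<close> corrects this.\<close>
  define X where "X = Y - P"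
  have X: "X \<in> carrier_mat n n" using Y P by (simp add: X_def minus_carrier_mat)
  have AB: "A = B - P" using A P unfolding B_def by (intro eq_matI) auto
  have AY: "A * Y = 1\<^sub>m n - P" using minus_mult_distrib_mat[OF B P Y] by (simp add: AB BY PY)
  have YA: "Y * A = 1\<^sub>m n - P" using mult_minus_distrib_mat[OF Y B P] by (simp add: AB YB YP)
  have AX: "A * X = 1\<^sub>m n - P"
    using P mult_minus_distrib_mat[OF A Y P] by (simp add: X_def AY AP) auto
  have XA: "X * A = 1\<^sub>m n - P"
    using P minus_mult_distrib_mat[OF Y P A] by (simp add: X_def YA PA) auto
  have PX: "P * X = 0\<^sub>m n n"
    using P mult_minus_distrib_mat[OF P Y P] by (simp add: X_def PY PP)
  have I: "1\<^sub>m n \<in> carrier_mat n n" by simp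
  have "A * X * A = A"
    using A minus_mult_distrib_mat[OF I P A] by (simp add: AX PA) auto
  moreover have "X * A * X = X"
    using X minus_mult_distrib_mat[OF I P X] by (simp add: XA PX) auto
  moreover have "transpose_mat (1\<^sub>m n - P) = 1\<^sub>m n - P"
    using P PT by (simp add: transpose_minus[OF I P])
  ultimately have "is_mp_inverse A X"
    using A X by (auto simp: is_mp_inverse_def AX XA)
  then show ?thesis ..
qed

text \<open>Symmetry moves \<open>A\<close> across the scalar product, and
  \<open>A * X * A = A\<close> removes \<open>X\<close>, so no entry of the inverse has to be
  computed.\<close>

lemma mp_inverse_quadratic_form:
  fixes A :: "real mat"
  assumes A: "A \<in> carrier_mat n n" and AT: "transpose_mat A = A"
    and X: "is_mp_inverse A X" and v: "v \<in> carrier_vec n" and d: "A *\<^sub>v v = d"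
  shows "d \<bullet> (mp_inverse A *\<^sub>v d) = v \<bullet> d"
proof -
  have Xc: "X \<in> carrier_mat n n" and AXA: "A * X * A = A"
    using X A by (auto simp: is_mp_inverse_def)
  have dc: "d \<in> carrier_vec n" using A v d by auto
  have "(A *\<^sub>v v) \<bullet> (X *\<^sub>v d) = v \<bullet> (A *\<^sub>v (X *\<^sub>v d))"
    using transpose_vec_mult_scalar[OF A mult_mat_vec_carrier[OF Xc dc] v] AT A Xc v dc
    by (metis carrier_vecD mult_mat_vec_carrier comm_scalar_prod)
  also have "A *\<^sub>v (X *\<^sub>v d) = (A * X * A) *\<^sub>v v"
    using A Xc v dc by (simp add: d[symmetric] assoc_mult_mat_vec[of _ n n _ n])
  finally show ?thesis using AXA d mp_inverse_eqI[OF X] by simp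
qed

section \<open>The Laplacian of the straight linear 2-tree\<close>

text \<open>Adjacency for 0-based indices, written with sums because subtraction on
  \<open>nat\<close> truncates.\<close>

definition near :: "nat \<Rightarrow> nat \<Rightarrow> bool" where
  "near k l \<longleftrightarrow> k \<noteq> l \<and> k \<le> l + 2 \<and> l \<le> k + 2"

lemma edge_iff:
  "{Suc k, Suc l} \<in> straight_linear_2tree n \<longleftrightarrow> k < n \<and> l < n \<and> near k l"
proof -
  have "{a, b} \<in> straight_linear_2tree n \<longleftrightarrow>
      a \<in> {1..n} \<and> b \<in> {1..n} \<and> 0 < \<bar>int a - int b\<bar> \<and> \<bar>int a - int b\<bar> \<le> 2" for a b
    unfolding straight_linear_2tree_def by (auto simp: doubleton_eq_iff)
  from this[of "Suc k" "Suc l"] show ?thesis by (auto simp: near_def)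
qed

lemma degree_of_straight_linear_2tree:
  assumes "k < n"
  shows "degree_of (straight_linear_2tree n) (Suc k) = card {l. l < n \<and> near k l}"
proof -
  have "{e \<in> straight_linear_2tree n. Suc k \<in> e} = (\<lambda>l. {Suc k, Suc l}) ` {l. l < n \<and> near k l}"
    (is "?E = ?I")
  proof
    show "?I \<subseteq> ?E" using assms by (auto simp: edge_iff)
    show "?E \<subseteq> ?I"
    proof
      fix e assume e: "e \<in> ?E"
      then obtain i j where ij: "e = {i, j}" "i \<in> {1..n}" "j \<in> {1..n}"
        by (auto simp: straight_linear_2tree_def)
      with e obtain l' where l': "e = {Suc k, l'}" "l' \<in> {1..n}" by auto
      then obtain l where "l' = Suc l" by (cases l') auto
      with l' e show "e \<in> ?I" by (auto simp: edge_iff)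
    qed
  qed
  moreover have "inj_on (\<lambda>l. {Suc k, Suc l}) {l. l < n \<and> near k l}"
    by (auto simp: inj_on_def doubleton_eq_iff)
  ultimately show ?thesis by (simp add: degree_of_def card_image)
qed

abbreviation lap :: "nat \<Rightarrow> real mat" where
  "lap n \<equiv> laplacian n (straight_linear_2tree n)"

lemma lap_carrier: "lap n \<in> carrier_mat n n"
  by (simp add: laplacian_def)

lemma lap_symmetric: "transpose_mat (lap n) = lap n"
  by (intro eq_matI) (auto simp: laplacian_def insert_commute)

text \<open>Since the degree counts neighbours, the diagonal term spreads over them, and the product
  becomes the net current leaving a vertex at potentials \<open>f\<close>.\<close>

lemma lap_mult_vec:
  assumes "k < n"
  shows "(lap n *\<^sub>v vec n f) $ k = (\<Sum>l<n. if near k l then f k - f l else 0)"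
proof -
  have "(lap n *\<^sub>v vec n f) $ k = (\<Sum>l<n. lap n $$ (k, l) * f l)"
    using assms by (simp add: scalar_prod_def laplacian_def atLeast0LessThan)
  also have "\<dots> = (\<Sum>l<n. (if k = l then real (card {l. l < n \<and> near k l}) * f k else 0)
                         - (if near k l then f l else 0))"
    using assms
    by (intro sum.cong) (auto simp: laplacian_def degree_of_straight_linear_2tree edge_iff near_def)
  also have "\<dots> = real (card {l. l < n \<and> near k l}) * f k - (\<Sum>l<n. if near k l then f l else 0)"
    using assms by (simp add: sum_subtractf)
  also have "real (card {l. l < n \<and> near k l}) * f k = (\<Sum>l<n. if near k l then f k else 0)"
    by (simp add: sum.If_cases Int_def)
  finally show ?thesis
    by (simp add: sum_subtractf[symmetric] if_distrib cong: if_cong)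
qed

text \<open>Maximum principle: where \<open>f\<close> is maximal, nonnegative differences sum to 0,
  so all neighbours are maximal too. Consecutive indices are adjacent, hence the maximum spreads in
  both directions.\<close>

lemma lap_mult_vec_eq_0:
  assumes 0: "lap n *\<^sub>v vec n f = 0\<^sub>v n" and "k < n" "l < n"
  shows "f k = (f l :: real)"
proof -
  define M where "M = Max (f ` {..<n})"
  have ne: "f ` {..<n} \<noteq> {}" using \<open>k < n\<close> by auto
  have le: "f j \<le> M" if "j < n" for j
    using that by (auto simp: M_def)
  have adjacent: "f j = M" if "f i = M" "i < n" "j < n" "near i j" for i j
  proof -
    have "(\<Sum>l<n. if near i l then f i - f l else 0) = 0"
      using lap_mult_vec[OF \<open>i < n\<close>, of f] 0 \<open>i < n\<close> by simp
    then have "\<forall>l\<in>{..<n}. (if near i l then f i - f l else 0) = 0"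
      by (subst (asm) sum_nonneg_eq_0_iff) (auto simp: that(1) le)
    then show ?thesis using that by force
  qed
  have "M \<in> f ` {..<n}" unfolding M_def using ne by (intro Max_in) auto
  then obtain i where i: "i < n" "f i = M" by auto
  have up: "f j = M" if "i \<le> j" "j < n" for j
    using that
  proof (induction j rule: dec_induct)
    case (step j)
    then show ?case using adjacent[of j "Suc j"] by (auto simp: near_def)
  qed (use i in auto)
  have down: "f j = M" if "j \<le> i" for j
    using that
  proof (induction j rule: inc_induct)
    case (step j)
    then show ?case using adjacent[of "Suc j" j] i by (auto simp: near_def)
  qed (use i in auto)
  have "f j = M" if "j < n" for j using up down that by (meson nle_le)
  then show ?thesis using assms by simp
qed

lemma lap_has_mp_inverse: "\<exists>X. is_mp_inverse (lap n) X"
proof (rule is_mp_inverse_exists[where P = "mat n n (\<lambda>_. 1 / real n)" and n = n])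
  let ?P = "mat n n (\<lambda>_. 1 / real n)"
  show "transpose_mat ?P = ?P" by (intro eq_matI) auto
  show "?P * ?P = ?P" by (intro eq_matI) (auto simp: scalar_prod_def)
  show AP: "lap n * ?P = 0\<^sub>m n n"
  proof (intro eq_matI)
    fix i j assume ij: "i < dim_row (0\<^sub>m n n)" "j < dim_col (0\<^sub>m n n)"
    have "(lap n * ?P) $$ (i, j) = (lap n *\<^sub>v vec n (\<lambda>_. 1 / real n)) $ i"
      using ij lap_carrier[of n] by (auto simp: scalar_prod_def)
    then show "(lap n * ?P) $$ (i, j) = 0\<^sub>m n n $$ (i, j)"
      using ij by (simp add: lap_mult_vec del: index_mult_mat_vec cong: if_cong)
  qed (use lap_carrier[of n] in auto)
  have "?P * lap n = transpose_mat (lap n * ?P)"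
    by (subst transpose_mult[OF lap_carrier]) (auto simp: lap_symmetric \<open>transpose_mat ?P = ?P\<close>)
  then show "?P * lap n = 0\<^sub>m n n" by (simp add: AP)
  show "v = 0\<^sub>v n" if v: "v \<in> carrier_vec n" and A0: "lap n *\<^sub>v v = 0\<^sub>v n"
    and P0: "?P *\<^sub>v v = 0\<^sub>v n" for v
  proof
    fix i assume i: "i < dim_vec (0\<^sub>v n)"
    have vv: "v = vec n (($) v)" using v by (intro eq_vecI) auto
    \<comment> \<open>A kernel vector is constant, so each entry equals its mean; \<open>?P\<close>
      computes that mean, which is 0.\<close>
    have c: "v $ l = v $ i" if "l < n" for l
      using lap_mult_vec_eq_0[of n "($) v" l i] A0 vv that i by simp
    have "0 = (?P *\<^sub>v v) $ i" using P0 i by simp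
    also have "\<dots> = (\<Sum>l<n. v $ l / real n)"
      using v i by (simp add: scalar_prod_def atLeast0LessThan)
    also have "\<dots> = (\<Sum>l<n. v $ i / real n)"
      by (intro sum.cong refl) (metis c lessThan_iff)
    also have "\<dots> = v $ i" using i by simp
    finally show "v $ i = 0\<^sub>v n $ i" using i by simp
  qed (use v in auto)
qed (auto simp: lap_carrier)

text \<open>Here \<open>f\<close> is a potential for unit current entering at \<open>Suc i\<close>
  and leaving at \<open>Suc j\<close>; pairing it with this current gives the voltage drop.\<close>

lemma resistance_eq_potential_difference:
  assumes v: "lap n *\<^sub>v vec n f = unit_vec n i - unit_vec n j" and ij: "i < n" "j < n"
  shows "resistance n (straight_linear_2tree n) (Suc i) (Suc j) = f i - f j"
proof -
  obtain X where X: "is_mp_inverse (lap n) X" using lap_has_mp_inverse by blast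
  have "resistance n (straight_linear_2tree n) (Suc i) (Suc j)
      = vec n f \<bullet> (unit_vec n i - unit_vec n j)"
    using mp_inverse_quadratic_form[OF lap_carrier lap_symmetric X _ v]
    by (simp add: resistance_def)
  also have "\<dots> = f i - f j"
    using ij by (subst scalar_prod_minus_distrib[of _ n]) auto
  finally show ?thesis .
qed

section \<open>The potential\<close>

text \<open>Fibonacci numbers on all integers, with F(-k) = (-1)^(k+1) F(k), so that the recurrence
  has no exceptions.\<close>

definition fibz :: "int \<Rightarrow> real" where
  "fibz z = (if 0 \<le> z then real (fib (nat z))
             else if even z then - real (fib (nat (- z))) else real (fib (nat (- z))))"

lemma fibz_add_2: "fibz (z + 2) = fibz (z + 1) + fibz z"
proof -
  consider "z \<ge> 0" | "z = - 1" | "z \<le> - 2" by linarith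
  then show ?thesis
  proof cases
    case 1
    then obtain k where "z = int k" using nonneg_int_cases by blast
    then show ?thesis by (simp add: fibz_def nat_add_distrib numeral_2_eq_2)
  next
    case 2
    then show ?thesis by (simp add: fibz_def)
  next
    case 3
    define k where "k = nat (- z - 2)"
    have z: "z = - int k - 2" using 3 by (simp add: k_def)
    have "nat (2 + int k) = Suc (Suc k)" "nat (int k + 2) = Suc (Suc k)" "nat (int k + 1) = Suc k" by auto
    \<comment> \<open>For \<open>k = 0\<close> the index \<open>z + 2\<close> is 0 and falls under
      the nonnegative branch of \<open>fibz\<close>.\<close>
    then show ?thesis by (cases "k = 0") (auto simp: z fibz_def)
  qed
qed

lemma fibz_minus: "fibz (- z) = (if even z then - fibz z else fibz z)"
  by (auto simp: fibz_def)

lemma lucas_eq_fibz: "real (lucas p) = fibz (int p + 1) + fibz (int p - 1)"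
  by (cases p) (auto simp: fibz_def nat_add_distrib)

lemma lucas_pos: "lucas p > 0"
  by (cases p) (auto simp: fib_neq_0_nat)

text \<open>Kirchhoff's equations across the cuts \<open>{0..k}\<close> read
  \<open>a (k - 1) + 3 * a k + a (k + 1) = 1\<close> for \<open>a k = V k - V (k + 1)\<close>, whence the shape of \<open>V\<close>; it is
  taken on all integers so that a missing neighbour becomes a boundary condition.\<close>

definition potential :: "nat \<Rightarrow> int \<Rightarrow> real" where
  "potential p z = - of_int z / 5
     + (if even z then 1 else - 1) * (2 / (5 * real (lucas p))) * fibz (int p - 2 * z)"

text \<open>For solutions x^z, put s = x + 1/x: the equation becomes s^2 + s - 6 = 0. The root s = 2
  gives the linear term, and s = -3 the alternating Fibonacci term.\<close>

lemma potential_harmonic: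
  "4 * potential p z = potential p (z - 2) + potential p (z - 1) + potential p (z + 1) + potential p (z + 2)"
proof -
  \<comment> \<open>The smallest Fibonacci index that occurs; all others reduce to the values at
    \<open>y\<close> and \<open>y + 1\<close>.\<close>
  define y where "y = int p - 2 * z - 4"
  have e: "int p - 2 * z = y + 4" "int p - 2 * (z - 2) = y + 8" "int p - 2 * (z - 1) = y + 6"
    "int p - 2 * (z + 1) = y + 2" "int p - 2 * (z + 2) = y"
    by (simp_all add: y_def)
  have r: "fibz (y + 2) = fibz (y + 1) + fibz y" "fibz (y + 3) = 2 * fibz (y + 1) + fibz y"
    "fibz (y + 4) = 3 * fibz (y + 1) + 2 * fibz y" "fibz (y + 5) = 5 * fibz (y + 1) + 3 * fibz y"
    "fibz (y + 6) = 8 * fibz (y + 1) + 5 * fibz y" "fibz (y + 7) = 13 * fibz (y + 1) + 8 * fibz y"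
    "fibz (y + 8) = 21 * fibz (y + 1) + 13 * fibz y"
    using fibz_add_2[of y] fibz_add_2[of "y + 1"] fibz_add_2[of "y + 2"] fibz_add_2[of "y + 3"]
      fibz_add_2[of "y + 4"] fibz_add_2[of "y + 5"] fibz_add_2[of "y + 6"]
    by (simp_all add: add.assoc)
  define c where "c = 2 / (5 * real (lucas p))"
  show ?thesis
    unfolding potential_def e r c_def[symmetric]
    by (cases "even z") (simp_all add: algebra_simps add_divide_distrib diff_divide_distrib)
qed

text \<open>The fictitious vertices -1 and -2 must feed no current into vertex 1 and a unit current
  into vertex 0. Both conditions reduce to \<open>c * real (lucas p) = 2 / 5\<close>, which fixes
  the coefficient in \<open>potential\<close>.\<close>

lemma
  shows potential_minus_1: "potential p (- 1) = potential p 1"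
    and potential_minus_2: "potential p (- 2) = 1 + 2 * potential p 0 - potential p 1"
proof -
  define y where "y = int p - 2"
  have e: "int p - 2 * (- 1) = y + 4" "int p - 2 * (- 2) = y + 6" "int p - 2 * 0 = y + 2"
    "int p - 2 * 1 = y" "int p + 1 = y + 3" "int p - 1 = y + 1"
    by (simp_all add: y_def)
  have r: "fibz (y + 2) = fibz (y + 1) + fibz y" "fibz (y + 3) = 2 * fibz (y + 1) + fibz y"
    "fibz (y + 4) = 3 * fibz (y + 1) + 2 * fibz y" "fibz (y + 5) = 5 * fibz (y + 1) + 3 * fibz y"
    "fibz (y + 6) = 8 * fibz (y + 1) + 5 * fibz y"
    using fibz_add_2[of y] fibz_add_2[of "y + 1"] fibz_add_2[of "y + 2"] fibz_add_2[of "y + 3"]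
      fibz_add_2[of "y + 4"]
    by (simp_all add: add.assoc)
  have L: "real (lucas p) = 3 * fibz (y + 1) + fibz y"
    unfolding lucas_eq_fibz e r by simp
  define c where "c = 2 / (5 * real (lucas p))"
  have "c * real (lucas p) = 2 / 5" using lucas_pos[of p] by (simp add: c_def)
  then have "c * (3 * fibz (y + 1) + fibz y) = 2 / 5" unfolding L .
  then show "potential p (- 1) = potential p 1"
    "potential p (- 2) = 1 + 2 * potential p 0 - potential p 1"
    unfolding potential_def e r c_def[symmetric] by (simp_all add: algebra_simps)
qed

text \<open>Reversing the graph negates the Fibonacci index \<open>int p - 2 * z\<close>. For either
  parity of \<open>p\<close> the alternating term changes sign, so the boundary conditions carry
  over to the other end.\<close>

lemma potential_reflect: "potential p (int p - z) = - real p / 5 - potential p z"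
proof -
  have "int p - 2 * (int p - z) = - (int p - 2 * z)" by simp
  then show ?thesis
    unfolding potential_def by (simp only: fibz_minus) (auto simp: field_simps)
qed

section \<open>Kirchhoff's current law at every vertex\<close>

lemma sum_near:
  "(\<Sum>l<n. if near k l then g l else (0::real)) =
     (if 2 \<le> k \<and> k < n + 2 then g (k - 2) else 0) + (if 1 \<le> k \<and> k < n + 1 then g (k - 1) else 0)
     + (if k + 1 < n then g (k + 1) else 0) + (if k + 2 < n then g (k + 2) else 0)"
proof -
  \<comment> \<open>Each of the at most four neighbours gets its own indicator. The inner guards
    discard the spurious index 0 produced by truncated subtraction.\<close>
  have "(\<Sum>l<n. if near k l then g l else 0) =
     (\<Sum>l<n. (if l = k - 2 then if 2 \<le> k then g (k - 2) else 0 else 0)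
        + (if l = k - 1 then if 1 \<le> k then g (k - 1) else 0 else 0)
        + (if l = k + 1 then g (k + 1) else 0) + (if l = k + 2 then g (k + 2) else 0))"
  proof (intro sum.cong refl)
    fix l
    consider "k = l + 2" | "k = l + 1" | "l = k + 1" | "l = k + 2" | "\<not> near k l"
      by (fastforce simp: near_def)
    then show "(if near k l then g l else 0) =
        (if l = k - 2 then if 2 \<le> k then g (k - 2) else 0 else 0)
        + (if l = k - 1 then if 1 \<le> k then g (k - 1) else 0 else 0)
        + (if l = k + 1 then g (k + 1) else 0) + (if l = k + 2 then g (k + 2) else 0)"
    proof cases
      case 5
      then have "l = k - 2 \<longrightarrow> \<not> 2 \<le> k" "l = k - 1 \<longrightarrow> \<not> 1 \<le> k" "l \<noteq> k + 1" "l \<noteq> k + 2"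
        by (auto simp: near_def)
      then show ?thesis using 5 by simp
    qed (simp_all add: near_def, arith+)
  qed
  then show ?thesis by (auto simp: sum.distrib)
qed

lemma lap_potential:
  assumes "p \<ge> 2"
  shows "lap (Suc p) *\<^sub>v vec (Suc p) (\<lambda>k. potential p (int k)) = unit_vec (Suc p) 0 - unit_vec (Suc p) p"
proof
  fix k assume "k < dim_vec (unit_vec (Suc p) 0 - unit_vec (Suc p) p :: real vec)"
  then have k: "k \<le> p" by simp
  let ?V = "potential p"
  have e: "int p - (- 1) = int p + 1" "int p - (- 2) = int p + 2" by simp_all
  have top: "?V (int p + 1) = ?V (int p - 1)" "?V (int p + 2) = - 1 + 2 * ?V (int p) - ?V (int p - 1)"
    using potential_reflect[of p "- 1"] potential_reflect[of p "- 2"] potential_reflect[of p 0]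
      potential_reflect[of p 1] potential_minus_1[of p] potential_minus_2[of p]
    unfolding e by (simp_all add: field_simps)
  have "(lap (Suc p) *\<^sub>v vec (Suc p) (\<lambda>k. ?V (int k))) $ k =
     (if 2 \<le> k then ?V k - ?V (int k - 2) else 0) + (if 1 \<le> k then ?V k - ?V (int k - 1) else 0)
     + (if k + 1 \<le> p then ?V k - ?V (int k + 1) else 0) + (if k + 2 \<le> p then ?V k - ?V (int k + 2) else 0)"
    using k
    by (subst lap_mult_vec, simp, cases "k = 1") (auto simp: sum_near of_nat_diff add.commute)
  also have "\<dots> = (if k = 0 then 1 else 0) - (if k = p then 1 else 0)"
  proof -
    have h: "4 * ?V k = ?V (int k - 2) + ?V (int k - 1) + ?V (int k + 1) + ?V (int k + 2)"
      by (rule potential_harmonic)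
    \<comment> \<open>The cases record which neighbours are missing. For \<open>p = 2\<close> the
      middle vertex lacks one on each side; in the last case all four exist and \<open>h\<close>
      suffices.\<close>
    consider "k = 0" | "k = 1" "p = 2" | "k = 1" "p \<ge> 3" | "2 \<le> k" "k = p"
      | "2 \<le> k" "p = k + 1" | "2 \<le> k" "k + 2 \<le> p"
      using assms k by linarith
    then show ?thesis
    proof cases
      case 1
      have "4 * ?V 0 = ?V (- 2) + ?V (- 1) + ?V 1 + ?V 2" using h unfolding 1 by simp
      then have "2 * ?V 0 - ?V 1 - ?V 2 = 1"
        using potential_minus_1[of p] potential_minus_2[of p] by linarith
      then show ?thesis unfolding 1 using assms by simp
    next
      case 2
      have "4 * ?V 1 = ?V (- 1) + ?V 0 + ?V 2 + ?V 3" using h unfolding 2(1) by simp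
      moreover have "?V 3 = ?V 1" using top(1) 2(2) by simp
      ultimately have "2 * ?V 1 - ?V 0 - ?V 2 = 0"
        using potential_minus_1[of p] by linarith
      then show ?thesis unfolding 2 by simp
    next
      case 3
      have "4 * ?V 1 = ?V (- 1) + ?V 0 + ?V 2 + ?V 3" using h unfolding 3(1) by simp
      then have "3 * ?V 1 - ?V 0 - ?V 2 - ?V 3 = 0"
        using potential_minus_1[of p] by linarith
      then show ?thesis unfolding 3(1) using 3(2) by simp
    next
      case 4
      have "?V p - ?V (int p - 2) + (?V p - ?V (int p - 1)) = - 1"
        using h top unfolding 4(2) by linarith
      then show ?thesis unfolding 4(2) using assms by simp
    next
      case 5
      have ik: "int k = int p - 1" and cond: "1 \<le> k" "k + 1 \<le> p" "\<not> k + 2 \<le> p" "k \<noteq> 0" "k \<noteq> p"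
        using 5 by auto
      have "4 * ?V (int p - 1) = ?V (int p - 3) + ?V (int p - 2) + ?V p + ?V (int p + 1)"
        using h unfolding ik by (simp add: add.commute)
      then have "3 * ?V (int p - 1) - ?V (int p - 3) - ?V (int p - 2) - ?V p = 0"
        using top(1) by linarith
      then show ?thesis unfolding ik by (simp only: 5(1) cond if_True if_False simp_thms) simp
    next
      case 6
      then have "(if k = 0 then 1 else 0) - (if k = p then 1 else 0) = (0 :: real)" by simp
      moreover have "1 \<le> k" "k + 1 \<le> p" using 6 by simp_all
      ultimately show ?thesis using 6 by (simp only: if_True) (use h in linarith)
    qed
  qed
  finally show "(lap (Suc p) *\<^sub>v vec (Suc p) (\<lambda>k. ?V (int k))) $ k
      = (unit_vec (Suc p) 0 - unit_vec (Suc p) p) $ k"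
    using k by auto
qed (simp add: laplacian_def)

lemma resistance_straight_linear_2tree:
  assumes "p \<ge> 2"
  shows "resistance (Suc p) (straight_linear_2tree (Suc p)) 1 (Suc p)
    = real p / 5 + 4 * real (fib p) / (5 * real (lucas p))"
proof -
  have "resistance (Suc p) (straight_linear_2tree (Suc p)) 1 (Suc p) = potential p 0 - potential p (int p)"
    using resistance_eq_potential_difference[OF lap_potential[OF assms]] by simp
  \<comment> \<open>The drop is thus \<open>real p / 5 + 2 * potential p 0\<close>, where the linear
    term vanishes at 0 and only the Fibonacci term remains.\<close>
  also have "potential p (int p) = - real p / 5 - potential p 0"
    using potential_reflect[of p 0] by simp
  finally show ?thesis by (simp add: potential_def fibz_def)
qed

section \<open>The sum\<close>

lemma fib_lucas_sum:
  assumes "m \<ge> 1"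
  shows "2 * (real (fib (m + 1)))\<^sup>2 / (real (lucas (m + 1)) * real (lucas m))
           + (\<Sum>i = 1..m - 1. (real (fib i) * real (fib (i + 1)))
                              / (real (lucas i) * real (lucas (i + 1))))
         = (real m + 1) / 5 + 4 * real (fib (m + 1)) / (5 * real (lucas (m + 1)))"
  using assms
proof (induction m rule: nat_induct_at_least)
  case base
  \<comment> \<open>For m = 1 the sum is empty and both sides equal 2/3.\<close>
  have "lucas 2 = 3" "fib 2 = 1" by (simp_all add: numeral_2_eq_2)
  then show ?case by simp
next
  case (Suc m)
  define a b where "a = real (fib m)" and "b = real (fib (m + 1))"
  have F: "real (fib m) = a" "real (fib (m + 1)) = b" "real (fib (Suc m + 1)) = a + b" "real (fib (Suc m)) = b"
    by (simp_all add: a_def b_def)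
  have "m = Suc (m - 1)" using Suc.hyps by simp
  \<comment> \<open>Exposing the predecessor lets \<open>lucas m\<close> unfold, with F(m-1) = b - a
    giving 2b - a.\<close>
  then obtain j where j: "m = Suc j" by blast
  have L: "real (lucas m) = 2 * b - a" "real (lucas (m + 1)) = 2 * a + b"
    "real (lucas (Suc m + 1)) = a + 3 * b" "real (lucas (Suc m)) = 2 * a + b"
    unfolding a_def b_def j by simp_all
  have nz: "2 * b - a \<noteq> 0" "2 * a + b \<noteq> 0" "a + 3 * b \<noteq> 0"
    using lucas_pos[of m] lucas_pos[of "m + 1"] lucas_pos[of "Suc m + 1"] unfolding L[symmetric]
    by (simp_all del: lucas.simps)
  define S where "S = (\<Sum>i = 1..m - 1. (real (fib i) * real (fib (i + 1)))
                              / (real (lucas i) * real (lucas (i + 1))))"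
  have S: "(\<Sum>i = 1..Suc m - 1. (real (fib i) * real (fib (i + 1)))
      / (real (lucas i) * real (lucas (i + 1)))) = S + a * b / ((2 * b - a) * (2 * a + b))"
    unfolding S_def F[symmetric] L[symmetric] by (simp add: j)
  have IH: "S = (real m + 1) / 5 + 4 * b / (5 * (2 * a + b)) - 2 * b\<^sup>2 / ((2 * a + b) * (2 * b - a))"
    using Suc.IH unfolding S_def[symmetric] F L by simp
  \<comment> \<open>The change in the isolated quadratic term plus the new summand matches the
    change in the closed form, as an identity of rational functions in \<open>a\<close> and
    \<open>b\<close>.\<close>
  have "2 * (a + b)\<^sup>2 / ((a + 3 * b) * (2 * a + b)) - 2 * b\<^sup>2 / ((2 * a + b) * (2 * b - a))
      + a * b / ((2 * b - a) * (2 * a + b))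
      = 1 / 5 + 4 * (a + b) / (5 * (a + 3 * b)) - 4 * b / (5 * (2 * a + b))"
    using nz by (simp add: divide_simps) (simp add: algebra_simps power2_eq_square)
  then show ?case unfolding S IH F L by (simp add: add_divide_distrib)
qed

theorem theorem3p4:
  fixes n m :: nat
  assumes "n \<ge> 3" and "m = n - 2"
  shows "resistance n (straight_linear_2tree n) 1 n =
           2 * (real (fib (m + 1)))\<^sup>2 / (real (lucas (m + 1)) * real (lucas m))
           + (\<Sum>i = 1..m - 1. (real (fib i) * real (fib (i + 1)))
                              / (real (lucas i) * real (lucas (i + 1))))
       \<and> 2 * (real (fib (m + 1)))\<^sup>2 / (real (lucas (m + 1)) * real (lucas m))
           + (\<Sum>i = 1..m - 1. (real (fib i) * real (fib (i + 1)))
                              / (real (lucas i) * real (lucas (i + 1))))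
         = (real m + 1) / 5 + 4 * real (fib (m + 1)) / (5 * real (lucas (m + 1)))"
proof -
  have m: "m \<ge> 1" and n: "n = Suc (m + 1)" using assms by simp_all
  have "resistance n (straight_linear_2tree n) 1 n
      = (real m + 1) / 5 + 4 * real (fib (m + 1)) / (5 * real (lucas (m + 1)))"
    using resistance_straight_linear_2tree[of "m + 1"] m unfolding n by simp
  then show ?thesis using fib_lucas_sum[OF m] by simp
qed

end
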